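(* Let $G$ be a graph, $k=\mathrm{mw}_{37}(G)$ and $\ell=k\cdot\pi_G(k)$. Then $G$ admits a neighbourhood cover of overlap $\ell^2$ and radius $38$.
   Context: Graphs are finite, simple, undirected; $N(v)$ is the open neighbourhood and $\mathrm{Ball}^t_G(v)$ the set of vertices at distance at most $t$ from $v$ in $G$. $\pi_G(m)=\max_{A\subseteq V(G),|A|\le m}|\{N(v)\cap A:v\in V(G)\}|$. For a partition $\mathcal P$ of $V(G)$ and $X\subseteq V(G)$, $X/\mathcal P$ is the set of parts intersecting $X$. For $R\subseteq\binom{V(G)}2$, $\mathrm{Ball}^r_R(v)$ is the radius-$r$ ball in $(V(G),R)$. $\mathcal P$ is homogeneous modulo $R$ if for all parts $X,Y$ (possibly equal), the pairs $\{x,y\}$, $x\in X,y\in Y,x\ne y$, not in $R$ are all edges of $G$ or all non-edges. A merge sequence for $G$ is $(\mathcal P_1,R_1),\dots,(\mathcal P_m,R_m)$ with $\mathcal P_1\preceq\dots\preceq\mathcal P_m$ partitions of $V(G)$, $\mathcal P_1$ into singletons, $\mathcal P_m=\{V(G)\}$, $R_1\subseteq\dots\subseteq R_m$, $\mathcal P_t$ homogeneous modulo $R_t$; its radius-$r$ width is $\max_{t<m}\max_v|\mathrm{Ball}^r_{R_{t+1}}(v)/\mathcal P_t|$; $\mathrm{mw}_r(G)$ is the minimum. A neighbourhood cover of $G$ of overlap $k$ and radius $t$ is a family $\mathcal K$ of non-empty subsets of $V(G)$ such that (i) for every $v\in V(G)$ there is $C\in\mathcal K$ with $N(v)\subseteq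 C$; (ii) for every $C\in\mathcal K$ there is $v\in V(G)$ with $C\subseteq\mathrm{Ball}^t_G(v)$; (iii) every $v\in V(G)$ lies in at most $k$ sets of $\mathcal K$. *)

theory Defs
  imports "HOL-Library.Disjoint_Sets" "HOL-Library.Ramsey" "HOL-Library.Extended_Nat"
begin

definition finite_graph :: "'a set \<Rightarrow> 'a set set \<Rightarrow> bool" where
  "finite_graph V E \<longleftrightarrow> finite V \<and> E \<subseteq> [V]\<^bsup>2\<^esup>"

definition nbhd :: "'a set set \<Rightarrow> 'a \<Rightarrow> 'a set" where
  "nbhd E v = {u. {v, u} \<in> E}"

text \<open>The least length of a walk from \<open>u\<close> to \<open>v\<close>; it is \<open>\<infinity>\<close> if there is none.\<close>

definition graph_dist :: "'a set set \<Rightarrow> 'a \<Rightarrow> 'a \<Rightarrow> enat" where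
  "graph_dist E u v = (INF n \<in> {n. (u, v) \<in> {(x, y). {x, y} \<in> E} ^^ n}. enat n)"

definition graph_ball :: "'a set \<Rightarrow> 'a set set \<Rightarrow> nat \<Rightarrow> 'a \<Rightarrow> 'a set" where
  "graph_ball V E r v = {u \<in> V. graph_dist E v u \<le> enat r}"

definition nbhd_complexity :: "'a set \<Rightarrow> 'a set set \<Rightarrow> nat \<Rightarrow> nat" where
  "nbhd_complexity V E m =
     Max ((\<lambda>A. card ((\<lambda>v. nbhd E v \<inter> A) ` V)) ` {A. A \<subseteq> V \<and> card A \<le> m})"

definition parts_meeting :: "'a set \<Rightarrow> 'a set set \<Rightarrow> 'a set set" where
  "parts_meeting X P = {Y \<in> P. X \<inter> Y \<noteq> {}}"

definition homogeneous_mod :: "'a set set \<Rightarrow> 'a set set \<Rightarrow> 'a set set \<Rightarrow> bool" where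
  "homogeneous_mod E R P \<longleftrightarrow>
     (\<forall>X\<in>P. \<forall>Y\<in>P.
        (\<forall>x\<in>X. \<forall>y\<in>Y. x \<noteq> y \<and> {x, y} \<notin> R \<longrightarrow> {x, y} \<in> E) \<or>
        (\<forall>x\<in>X. \<forall>y\<in>Y. x \<noteq> y \<and> {x, y} \<notin> R \<longrightarrow> {x, y} \<notin> E))"

text \<open>The sequence is \<open>(P 1, R 1), \<dots>, (P m, R m)\<close>; values at other indices are irrelevant.\<close>

definition merge_sequence ::
  "'a set \<Rightarrow> 'a set set \<Rightarrow> nat \<Rightarrow> (nat \<Rightarrow> 'a set set) \<Rightarrow> (nat \<Rightarrow> 'a set set) \<Rightarrow> bool" where
  "merge_sequence V E m P R \<longleftrightarrow>
     1 \<le> m \<and>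
     (\<forall>t\<in>{1..m}. partition_on V (P t) \<and> R t \<subseteq> [V]\<^bsup>2\<^esup> \<and> homogeneous_mod E (R t) (P t)) \<and>
     (\<forall>t\<in>{1..<m}. refines V (P t) (P (t + 1)) \<and> R t \<subseteq> R (t + 1)) \<and>
     P 1 = (\<lambda>v. {v}) ` V \<and> P m = {V}"

definition merge_sequence_width ::
  "'a set \<Rightarrow> nat \<Rightarrow> nat \<Rightarrow> (nat \<Rightarrow> 'a set set) \<Rightarrow> (nat \<Rightarrow> 'a set set) \<Rightarrow> nat" where
  "merge_sequence_width V r m P R =
     Max ((\<lambda>(t, v). card (parts_meeting (graph_ball V (R (t + 1)) r v) (P t))) ` ({1..<m} \<times> V))"

text \<open>
  The condition \<open>2 \<le> m\<close> ensures that the maximum defining the width ranges over a non-empty set.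
  It excludes only the one-term sequence of a one-vertex graph, so that such a graph
  has merge-width 1. The minimum exists whenever \<open>V\<close> is finite and non-empty.
\<close>

definition merge_width :: "nat \<Rightarrow> 'a set \<Rightarrow> 'a set set \<Rightarrow> nat" where
  "merge_width r V E =
     Inf {merge_sequence_width V r m P R | m P R. merge_sequence V E m P R \<and> 2 \<le> m}"

definition neighbourhood_cover ::
  "'a set \<Rightarrow> 'a set set \<Rightarrow> nat \<Rightarrow> nat \<Rightarrow> 'a set set \<Rightarrow> bool" where
  "neighbourhood_cover V E k t K \<longleftrightarrow>
     (\<forall>C\<in>K. C \<noteq> {} \<and> C \<subseteq> V) \<and>
     (\<forall>v\<in>V. \<exists>C\<in>K. nbhd E v \<subseteq> C) \<and>
     (\<forall>C\<in>K. \<exists>v\<in>V. C \<subseteq> graph_ball V E t v) \<and>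
     (\<forall>v\<in>V. card {C\<in>K. v \<in> C} \<le> k)"

lemma merge_sequence_exists:
  assumes "V \<noteq> {}"
  shows "\<exists>P R. merge_sequence V E 2 P R"
proof -
  have "merge_sequence V E 2 (\<lambda>t. if t = 1 then (\<lambda>v. {v}) ` V else {V}) (\<lambda>t. [V]\<^bsup>2\<^esup>)"
    using assms
    by (auto simp: merge_sequence_def homogeneous_mod_def partition_on_def disjoint_def refines_def)
  then show ?thesis by blast
qed

lemma merge_width_attained:
  assumes "V \<noteq> {}"
  shows "\<exists>m P R. merge_sequence V E m P R \<and> 2 \<le> m \<and>
           merge_sequence_width V r m P R = merge_width r V E"
proof -
  let ?S = "{merge_sequence_width V r m P R | m P R. merge_sequence V E m P R \<and> 2 \<le> m}"
  have "?S \<noteq> {}" using merge_sequence_exists[OF assms] by fastforce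
  then have "Inf ?S \<in> ?S" by (rule Inf_nat_def1)
  then show ?thesis unfolding merge_width_def by (smt (verit, best) mem_Collect_eq)
qed

end

theory Submission
  imports Defs "HOL-Library.Product_Lexorder"
begin

text \<open>
  Fix an optimal merge sequence. Label every edge \<open>xy\<close> by the last time \<open>s\<close> at which the parts
  \<open>X \<ni> x\<close>, \<open>Y \<ni> y\<close> of \<open>P s\<close> are completely adjacent modulo \<open>R s\<close> while \<open>X \<union> Y\<close> lies in no
  \<open>R s\<close>-ball of radius 4, together with \<open>X\<close> and \<open>Y\<close>. Being spread out forces the edges
  with a given label to cluster in \<open>G\<close> around at most two vertices, while after time \<open>s\<close> the edge
  \<open>xy\<close> has its ends at \<open>R\<close>-distance at most 8. Each vertex \<open>v\<close> picks the latest label among the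
  edges \<open>xy\<close> with \<open>x \<in> N(v)\<close>, and the neighbourhoods of all vertices with the same label and the
  same centre form one cluster.

  To bound the overlap at \<open>u\<close>, let \<open>s\<close> be the earliest label time over \<open>v \<in> N(u)\<close>. At time
  \<open>s + 1\<close> all of \<open>N(u)\<close> is \<open>R\<close>-close to \<open>u\<close>. If \<open>v\<close> picked \<open>xy\<close> with \<open>x\<close> far from \<open>u\<close>, homogeneity
  makes \<open>x\<close> a neighbour of every other \<open>v' \<in> N(u)\<close> in the part of \<open>v\<close>, so the label depends only on
  that part; if \<open>x\<close> is near and \<open>y\<close> far, it depends only on the part of \<open>x\<close>; if both are near, on the
  parts of \<open>x\<close> and \<open>y\<close>. As at most \<open>k\<close> parts are near \<open>u\<close>, this leaves at most \<open>2k\<^sup>2\<close> labels,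
  hence \<open>4k\<^sup>2\<close> clusters, and \<open>\<pi>(k) \<ge> 2\<close> as soon as there is an edge.
\<close>

section \<open>Balls and neighbourhoods\<close>

lemma sym_relpow: "sym r \<Longrightarrow> sym (r ^^ n)"
  by (induction n) (simp_all add: sym_conv_converse_eq converse_relcomp relpow_commute)

lemma mem_graph_ball_iff:
  "u \<in> graph_ball V E r v \<longleftrightarrow> u \<in> V \<and> (\<exists>n\<le>r. (v, u) \<in> {(x, y). {x, y} \<in> E} ^^ n)"
proof -
  let ?S = "{n. (v, u) \<in> {(x, y). {x, y} \<in> E} ^^ n}"
  have "(INF n\<in>?S. enat n) \<le> enat r \<longleftrightarrow> (\<exists>n\<le>r. n \<in> ?S)"
  proof
    assume le: "(INF n\<in>?S. enat n) \<le> enat r"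
    then have "enat ` ?S \<noteq> {}"
      by (metis Inf_empty enat.distinct(1) top_enat_def top.extremum_uniqueI)
    then have "Inf (enat ` ?S) \<in> enat ` ?S"
      by (meson ex_in_conv wellorder_InfI)
    then show "\<exists>n\<le>r. n \<in> ?S" using le by auto
  next
    assume "\<exists>n\<le>r. n \<in> ?S"
    then show "(INF n\<in>?S. enat n) \<le> enat r"
      by (meson INF_lower2 enat_ord_simps(1))
  qed
  then show ?thesis by (simp add: graph_ball_def graph_dist_def)
qed

lemma graph_ball_self: "v \<in> V \<Longrightarrow> v \<in> graph_ball V E r v"
  unfolding mem_graph_ball_iff by (metis le0 relpow_0_I)

lemma graph_ball_edge: "{v, u} \<in> E \<Longrightarrow> u \<in> V \<Longrightarrow> u \<in> graph_ball V E 1 v"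
  unfolding mem_graph_ball_iff by (intro conjI exI[of _ 1]) auto

lemma graph_ball_sym:
  assumes "u \<in> graph_ball V E r v" "v \<in> V"
  shows "v \<in> graph_ball V E r u"
proof -
  have "sym {(x, y). {x, y} \<in> E}"
    by (auto intro: symI simp: insert_commute)
  then show ?thesis
    using assms unfolding mem_graph_ball_iff by (meson sym_relpow symD)
qed

lemma graph_ball_trans:
  assumes "u \<in> graph_ball V E r v" "w \<in> graph_ball V E s u"
  shows "w \<in> graph_ball V E (r + s) v"
  using assms unfolding mem_graph_ball_iff by (meson add_mono relpow_trans)

lemma graph_ball_mono:
  assumes "r \<le> r'"
  shows "graph_ball V E r v \<subseteq> graph_ball V E r' v"
  using assms unfolding subset_iff mem_graph_ball_iff by (meson order_trans)

lemma graph_ball_no_edges: "graph_ball V {} r v \<subseteq> {v}"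
proof
  fix u assume "u \<in> graph_ball V {} r v"
  then obtain n where "(v, u) \<in> {(x, y). {x, y} \<in> ({} :: 'a set set)} ^^ n"
    unfolding mem_graph_ball_iff by blast
  then show "u \<in> {v}" by (cases n) auto
qed

lemma graph_ball_complete:
  assumes "v \<in> V" "1 \<le> r"
  shows "V \<subseteq> graph_ball V ([V]\<^bsup>2\<^esup>) r v"
proof
  fix u assume "u \<in> V"
  then have "u \<in> graph_ball V ([V]\<^bsup>2\<^esup>) 1 v"
    using assms(1) graph_ball_self[of v V] graph_ball_edge[of v u "[V]\<^bsup>2\<^esup>" V]
    by (cases "u = v") auto
  then show "u \<in> graph_ball V ([V]\<^bsup>2\<^esup>) r v"
    using graph_ball_mono[OF assms(2)] by (rule subsetD[rotated])
qed

lemma mem_nbhd_commute: "u \<in> nbhd E v \<longleftrightarrow> v \<in> nbhd E u"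
  by (simp add: nbhd_def insert_commute)

lemma finite_graph_edgeD:
  assumes "finite_graph V E" "{x, y} \<in> E"
  shows "x \<in> V \<and> y \<in> V \<and> x \<noteq> y"
proof -
  have "{x, y} \<in> [V]\<^bsup>2\<^esup>" using assms unfolding finite_graph_def by blast
  then show ?thesis by simp
qed

lemma nbhd_subset: "finite_graph V E \<Longrightarrow> nbhd E v \<subseteq> V"
  by (auto simp: nbhd_def dest: finite_graph_edgeD)

lemma finite_graph_obtain_edge:
  assumes "finite_graph V E" "E \<noteq> {}"
  obtains a b where "{a, b} \<in> E"
proof -
  obtain e where "e \<in> E" using assms(2) by blast
  moreover from this have "e \<in> [V]\<^bsup>2\<^esup>" using assms(1) by (auto simp: finite_graph_def)
  ultimately show ?thesis using that by (metis nsets2_E)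
qed

lemma finite_graph_finite: "finite_graph V E \<Longrightarrow> finite V"
  by (simp add: finite_graph_def)

lemma finite_nbhd: "finite_graph V E \<Longrightarrow> finite (nbhd E v)"
  using nbhd_subset finite_graph_finite by (rule finite_subset)

lemma finite_graph_nonempty:
  assumes "finite_graph V E" "E \<noteq> {}"
  shows "V \<noteq> {}"
  using finite_graph_obtain_edge[OF assms] finite_graph_edgeD[OF assms(1)] by (metis empty_iff)

lemma nbhd_complexity_ge:
  assumes "finite V" "A \<subseteq> V" "card A \<le> n"
  shows "card ((\<lambda>v. nbhd E v \<inter> A) ` V) \<le> nbhd_complexity V E n"
  unfolding nbhd_complexity_def using assms by (intro Max_ge) auto

lemma nbhd_complexity_pos:
  assumes "finite V" "V \<noteq> {}"
  shows "0 < nbhd_complexity V E n"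
proof -
  have "0 < card ((\<lambda>v. nbhd E v \<inter> {}) ` V)" using assms by (simp add: card_gt_0_iff)
  also have "\<dots> \<le> nbhd_complexity V E n" using assms(1) by (intro nbhd_complexity_ge) auto
  finally show ?thesis .
qed

lemma nbhd_complexity_ge_2:
  assumes "finite_graph V E" "E \<noteq> {}" "0 < n"
  shows "2 \<le> nbhd_complexity V E n"
proof -
  obtain a b where ab: "{a, b} \<in> E" using assms(1,2) by (rule finite_graph_obtain_edge)
  then have V: "finite V" "a \<in> V" "b \<in> V"
    using finite_graph_finite[OF assms(1)] finite_graph_edgeD[OF assms(1)] by auto
  have "nbhd E a \<inter> {a} = {}" "nbhd E b \<inter> {a} = {a}"
    using ab finite_graph_edgeD[OF assms(1), of a a] by (auto simp: nbhd_def insert_commute)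
  then have "{{}, {a}} \<subseteq> (\<lambda>v. nbhd E v \<inter> {a}) ` V" using V by blast
  then have "card {{}, {a}} \<le> card ((\<lambda>v. nbhd E v \<inter> {a}) ` V)"
    using V by (intro card_mono) auto
  also have "\<dots> \<le> nbhd_complexity V E n" using V assms(3) by (intro nbhd_complexity_ge) auto
  finally show ?thesis by simp
qed

section \<open>Finite choices and counting\<close>

lemma card_image_le_of_factor:
  assumes "finite C" "g ` S \<subseteq> C"
    and "\<And>v v'. v \<in> S \<Longrightarrow> v' \<in> S \<Longrightarrow> g v = g v' \<Longrightarrow> f v = f v'"
  shows "card (f ` S) \<le> card C"
proof (rule surj_card_le[OF assms(1)])
  have "f v = f (inv_into S g (g v))" if "v \<in> S" for v
    using assms(3) that by (metis f_inv_into_f image_eqI inv_into_into)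
  then show "f ` S \<subseteq> (\<lambda>c. f (inv_into S g c)) ` C"
    using assms(2) by auto
qed

lemma consistent_maximal_choice:
  fixes F :: "'b \<Rightarrow> 'l set" and h :: "'l \<Rightarrow> 'o :: linorder"
  assumes fin: "finite (\<Union>v\<in>A. F v)" and ne: "\<And>v. v \<in> A \<Longrightarrow> F v \<noteq> {}"
  obtains f where "\<And>v. v \<in> A \<Longrightarrow> is_arg_max h (\<lambda>L. L \<in> F v) (f v)"
    and "\<And>v v'. v \<in> A \<Longrightarrow> v' \<in> A \<Longrightarrow> f v \<in> F v' \<Longrightarrow> f v' \<in> F v \<Longrightarrow> f v = f v'"
proof -
  obtain g :: "'l \<Rightarrow> nat" where inj: "inj_on g (\<Union>v\<in>A. F v)"
    using finite_imp_inj_to_nat_seg[OF fin] by blast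
  \<comment> \<open>Ties of \<open>h\<close> are broken by one injective \<open>g\<close>, lexicographically.\<close>
  define rank where "rank L = (h L, g L)" for L
  have "\<exists>L\<in>F v. \<forall>L'\<in>F v. rank L' \<le> rank L" if "v \<in> A" for v
  proof -
    have fin_v: "finite (F v)" using fin by (rule finite_subset[rotated]) (use that in blast)
    then have "Max (rank ` F v) \<in> rank ` F v" using ne[OF that] by simp
    then show ?thesis using fin_v by (metis Max_ge finite_imageI imageE image_eqI)
  qed
  then obtain f where f: "\<And>v. v \<in> A \<Longrightarrow> f v \<in> F v"
    "\<And>v L. v \<in> A \<Longrightarrow> L \<in> F v \<Longrightarrow> rank L \<le> rank (f v)"
    by metis
  show ?thesis
  proof
    fix v assume v: "v \<in> A"
    show "is_arg_max h (\<lambda>L. L \<in> F v) (f v)"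
      using f[OF v] unfolding is_arg_max_linorder rank_def less_eq_prod_simp by (meson less_imp_le)
  next
    fix v v' assume v: "v \<in> A" "v' \<in> A" and mem: "f v \<in> F v'" "f v' \<in> F v"
    then have "rank (f v) = rank (f v')" using f(2) by (meson order_antisym)
    then have "g (f v) = g (f v')" by (simp add: rank_def)
    then show "f v = f v'" using inj mem v by (auto dest: inj_onD)
  qed
qed

section \<open>Partitions and homogeneity\<close>

definition part_of :: "'a set set \<Rightarrow> 'a \<Rightarrow> 'a set" where
  "part_of P x = \<Union>{X \<in> P. x \<in> X}"

lemma part_of_eqI:
  assumes "partition_on V P" "X \<in> P" "x \<in> X"
  shows "part_of P x = X"
proof -
  have "{Y \<in> P. x \<in> Y} = {X}"
    using assms by (auto simp: partition_on_def disjoint_def)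
  then show ?thesis by (simp add: part_of_def)
qed

lemma part_of_in:
  assumes "partition_on V P" "x \<in> V"
  shows "part_of P x \<in> P" "x \<in> part_of P x"
  using part_of_eqI[OF assms(1)] partition_onD1[OF assms(1)] assms(2) by (metis UnionE)+

lemma part_of_subset: "partition_on V P \<Longrightarrow> part_of P x \<subseteq> V"
  unfolding partition_on_def part_of_def by blast

lemma part_of_eq_refines:
  assumes "refines V P Q" "x \<in> V" "y \<in> V" "part_of P x = part_of P y"
  shows "part_of Q x = part_of Q y"
proof -
  have P: "partition_on V P" and Q: "partition_on V Q"
    using assms(1) by (auto simp: refines_def)
  obtain Y where Y: "Y \<in> Q" "part_of P x \<subseteq> Y"
    using assms(1) part_of_in(1)[OF P assms(2)] by (auto simp: refines_def)
  have "x \<in> Y" "y \<in> Y"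
    using Y(2) part_of_in(2)[OF P assms(2)] part_of_in(2)[OF P assms(3)] assms(4) by auto
  then show ?thesis using part_of_eqI[OF Q Y(1)] by simp
qed

definition complete_mod :: "'a set set \<Rightarrow> 'a set set \<Rightarrow> 'a set \<Rightarrow> 'a set \<Rightarrow> bool" where
  "complete_mod E R X Y \<longleftrightarrow> (\<forall>x\<in>X. \<forall>y\<in>Y. x \<noteq> y \<and> {x, y} \<notin> R \<longrightarrow> {x, y} \<in> E)"

lemma homogeneous_mod_complete_mod:
  assumes "homogeneous_mod E R P" "X \<in> P" "Y \<in> P" "x \<in> X" "y \<in> Y" "x \<noteq> y"
    and "{x, y} \<in> E" "{x, y} \<notin> R"
  shows "complete_mod E R X Y"
  using assms unfolding homogeneous_mod_def complete_mod_def by meson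

lemma complete_mod_far_adjacent:
  assumes "complete_mod E R X Y" "x \<in> X" "y \<in> Y" "y \<in> V" "y \<notin> graph_ball V R 1 x"
  shows "{x, y} \<in> E"
  using assms graph_ball_self graph_ball_edge unfolding complete_mod_def by metis

definition spread_pair :: "'a set \<Rightarrow> 'a set set \<Rightarrow> 'a set set \<Rightarrow> 'a set \<Rightarrow> 'a set \<Rightarrow> bool" where
  "spread_pair V E R X Y \<longleftrightarrow>
     complete_mod E R X Y \<and> \<not> (\<exists>z\<in>V. X \<union> Y \<subseteq> graph_ball V R 4 z)"

lemma spread_pair_far_point:
  assumes spread: "spread_pair V E R X Y" and V: "X \<subseteq> V" and a: "a \<in> X"
    and partner: "\<And>x. x \<in> X \<Longrightarrow> \<exists>y\<in>Y. y \<in> graph_ball V R 1 x"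
  shows "\<exists>b\<in>Y. b \<notin> graph_ball V R 3 a"
proof (rule ccontr)
  assume "\<not> ?thesis"
  then have Y: "Y \<subseteq> graph_ball V R 3 a" by blast
  have "x \<in> graph_ball V R 4 a" if x: "x \<in> X" for x
  proof -
    obtain y where y: "y \<in> Y" "y \<in> graph_ball V R 1 x" using partner[OF x] by blast
    then have "x \<in> graph_ball V R 1 y" using graph_ball_sym[OF y(2)] x V by auto
    moreover have "y \<in> graph_ball V R 3 a" using Y y(1) by auto
    ultimately have "x \<in> graph_ball V R (3 + 1) a" by (rule graph_ball_trans[rotated])
    then show ?thesis by simp
  qed
  moreover have "Y \<subseteq> graph_ball V R 4 a" using Y graph_ball_mono[of 3 4 V R a] by auto
  ultimately show False using spread a V unfolding spread_pair_def by blast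
qed

lemma spread_pair_dominated_by_two:
  assumes spread: "spread_pair V E R X Y" and V: "X \<subseteq> V" "Y \<subseteq> V" and a: "a \<in> X"
    and partner: "\<And>x. x \<in> X \<Longrightarrow> \<exists>y\<in>Y. y \<in> graph_ball V R 1 x"
  shows "\<exists>b\<in>Y. \<exists>b'\<in>Y. \<forall>x\<in>X. {x, b} \<in> E \<or> {x, b'} \<in> E"
proof -
  have complete: "complete_mod E R X Y" using spread by (simp add: spread_pair_def)
  obtain b where b: "b \<in> Y" "b \<in> graph_ball V R 1 a" using partner[OF a] by blast
  obtain b' where b': "b' \<in> Y" "b' \<notin> graph_ball V R 3 a"
    using spread_pair_far_point[OF spread V(1) a partner] by blast
  have "{x, b} \<in> E \<or> {x, b'} \<in> E" if x: "x \<in> X" for x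
  proof -
    have "b \<notin> graph_ball V R 1 x \<or> b' \<notin> graph_ball V R 1 x"
    proof (rule ccontr)
      assume "\<not> ?thesis"
      then have "x \<in> graph_ball V R 1 b" "b' \<in> graph_ball V R 1 x"
        using graph_ball_sym[of b V R 1 x] x V by auto
      from graph_ball_trans[OF graph_ball_trans[OF b(2) this(1)] this(2)]
      show False using b'(2) by (simp add: numeral_3_eq_3)
    qed
    then show ?thesis
      using complete_mod_far_adjacent[OF complete x b(1)]
        complete_mod_far_adjacent[OF complete x b'(1)] b(1) b'(1) V(2) by blast
  qed
  then show ?thesis using b(1) b'(1) by blast
qed

lemma graph_ball_common_neighbour:
  assumes "finite_graph V E" "{x, y} \<in> E" "{z, y} \<in> E"
  shows "x \<in> graph_ball V E 2 z"
proof -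
  have "y \<in> graph_ball V E 1 z" "x \<in> graph_ball V E 1 y"
    using assms(2,3) finite_graph_edgeD[OF assms(1), of x y] graph_ball_edge[of z y E V]
      graph_ball_edge[of y x E V] insert_commute[of x y] by auto
  from graph_ball_trans[OF this] show ?thesis by (simp add: numeral_2_eq_2)
qed

lemma spread_pair_two_centres:
  assumes graph: "finite_graph V E" and spread: "spread_pair V E R X Y"
    and V: "X \<subseteq> V" "Y \<subseteq> V"
  shows "\<exists>Z\<subseteq>V. card Z \<le> 2 \<and>
           (\<forall>x\<in>X. \<forall>y\<in>Y. {x, y} \<in> E \<longrightarrow> (\<exists>z\<in>Z. x \<in> graph_ball V E 2 z))"
proof -
  consider (empty) "X = {}"
    | (isolated) a where "a \<in> X" "Y \<inter> graph_ball V R 1 a = {}"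
    | (partnered) a where "a \<in> X" "\<And>x. x \<in> X \<Longrightarrow> \<exists>y\<in>Y. y \<in> graph_ball V R 1 x"
    by blast
  then show ?thesis
  proof cases
    case empty
    then show ?thesis by (intro exI[of _ "{}"]) simp
  next
    case isolated
    then have "{a, y} \<in> E" if "y \<in> Y" for y
      using complete_mod_far_adjacent[of E R X Y a y V] spread that V(2)
      unfolding spread_pair_def by blast
    then have "x \<in> graph_ball V E 2 a" if "y \<in> Y" "{x, y} \<in> E" for x y
      using graph_ball_common_neighbour[OF graph that(2)] that(1) by blast
    then show ?thesis using isolated(1) V by (intro exI[of _ "{a}"]) auto
  next
    case partnered
    obtain b b' where b: "b \<in> Y" "b' \<in> Y"
      and dominated: "\<And>x. x \<in> X \<Longrightarrow> {x, b} \<in> E \<or> {x, b'} \<in> E"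
      using spread_pair_dominated_by_two[OF spread V partnered] by blast
    have "\<exists>z\<in>{b, b'}. x \<in> graph_ball V E 2 z" if x: "x \<in> X" for x
    proof -
      have "{b, x} \<in> E \<or> {b', x} \<in> E" using dominated[OF x] by (simp add: insert_commute)
      then have "x \<in> graph_ball V E 1 b \<or> x \<in> graph_ball V E 1 b'"
        using graph_ball_edge[of _ x E V] x V(1) by auto
      then show ?thesis using graph_ball_mono[of 1 2 V E] by auto
    qed
    moreover have "card {b, b'} \<le> 2" by (simp add: card_insert_if)
    ultimately show ?thesis using b V(2) by (intro exI[of _ "{b, b'}"]) auto
  qed
qed

section \<open>Neighbourhood covers from labellings\<close>

lemma neighbourhood_cover_mono:
  assumes "neighbourhood_cover V E k t K" "k \<le> k'" "t \<le> t'"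
  shows "neighbourhood_cover V E k' t' K"
  using assms(1,2) graph_ball_mono[OF assms(3)] unfolding neighbourhood_cover_def
  by (meson order_trans)

lemma neighbourhood_cover_no_edges:
  assumes "V \<noteq> {} \<Longrightarrow> 1 \<le> n"
  shows "\<exists>K. neighbourhood_cover V {} n r K"
proof (cases "V = {}")
  case True
  then have "neighbourhood_cover V {} n r {}" by (simp add: neighbourhood_cover_def)
  then show ?thesis by blast
next
  case False
  then obtain v where v: "v \<in> V" by blast
  have "card {C \<in> {{v}}. u \<in> C} \<le> card {{v}}" for u by (intro card_mono) auto
  then have "card {C \<in> {{v}}. u \<in> C} \<le> n" for u
    using assms[OF False] order_trans by fastforce
  then have "neighbourhood_cover V {} n r {{v}}"
    using v graph_ball_self[OF v] unfolding neighbourhood_cover_def nbhd_def by blast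
  then show ?thesis by blast
qed

lemma neighbourhood_cover_of_clustering:
  fixes key :: "'a \<Rightarrow> 'b" and centre :: "'b \<Rightarrow> 'a"
  assumes graph: "finite_graph V E" "E \<noteq> {}"
    and centre: "\<And>v. nbhd E v \<noteq> {} \<Longrightarrow>
          centre (key v) \<in> V \<and> nbhd E v \<subseteq> graph_ball V E r (centre (key v))"
    and keys: "\<And>u. card (key ` nbhd E u) \<le> n"
  shows "\<exists>K. neighbourhood_cover V E n r K"
proof -
  define cluster where "cluster \<kappa> = \<Union>{nbhd E v | v. key v = \<kappa>}" for \<kappa>
  define K where "K = {cluster (key v) | v. nbhd E v \<noteq> {}}"
  have nbhd_cluster: "nbhd E v \<subseteq> cluster (key v)" for v by (auto simp: cluster_def)
  have "neighbourhood_cover V E n r K"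
    unfolding neighbourhood_cover_def
  proof (intro conjI ballI)
    fix C assume "C \<in> K"
    then obtain v where v: "nbhd E v \<noteq> {}" "C = cluster (key v)" by (auto simp: K_def)
    show "C \<noteq> {}" using nbhd_cluster v by auto
    show "C \<subseteq> V" using nbhd_subset[OF graph(1)] v(2) by (auto simp: cluster_def)
    have "nbhd E v' \<subseteq> graph_ball V E r (centre (key v))" if "key v' = key v" for v'
      using centre[of v'] that by (cases "nbhd E v' = {}") auto
    then have "C \<subseteq> graph_ball V E r (centre (key v))" using v(2) by (auto simp: cluster_def)
    then show "\<exists>v\<in>V. C \<subseteq> graph_ball V E r v" using centre[OF v(1)] by blast
  next
    fix v
    obtain a b where "{a, b} \<in> E" using graph by (rule finite_graph_obtain_edge)
    then have "nbhd E a \<noteq> {}" by (auto simp: nbhd_def)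
    then have "cluster (key (if nbhd E v = {} then a else v)) \<in> K" by (auto simp: K_def)
    then show "\<exists>C\<in>K. nbhd E v \<subseteq> C" using nbhd_cluster[of v] by (cases "nbhd E v = {}") auto
  next
    fix u
    have "u \<in> nbhd E v \<Longrightarrow> cluster (key v) \<in> cluster ` key ` nbhd E u" for v
      by (simp add: mem_nbhd_commute[of u])
    then have "{C \<in> K. u \<in> C} \<subseteq> cluster ` key ` nbhd E u"
      by (fastforce simp: K_def cluster_def)
    then have "card {C \<in> K. u \<in> C} \<le> card (key ` nbhd E u)"
      using finite_nbhd[OF graph(1)] by (intro surj_card_le) auto
    also have "\<dots> \<le> n" by (rule keys)
    finally show "card {C \<in> K. u \<in> C} \<le> n" .
  qed
  then show ?thesis by blast
qed

lemma neighbourhood_cover_of_labelling: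
  fixes lab :: "'a \<Rightarrow> 'l" and Z :: "'l \<Rightarrow> 'a set"
  assumes graph: "finite_graph V E" "E \<noteq> {}"
    and Z: "\<And>L. Z L \<subseteq> V" "\<And>L. card (Z L) \<le> d"
    and near: "\<And>v. nbhd E v \<noteq> {} \<Longrightarrow> \<exists>c\<in>Z (lab v). nbhd E v \<subseteq> graph_ball V E r c"
    and labels: "\<And>u. card (lab ` nbhd E u) \<le> n"
  shows "\<exists>K. neighbourhood_cover V E (n * d) r K"
proof -
  obtain centre where centre: "\<And>v. nbhd E v \<noteq> {} \<Longrightarrow>
      centre v \<in> Z (lab v) \<and> nbhd E v \<subseteq> graph_ball V E r (centre v)"
    using near by metis
  show ?thesis
  proof (rule neighbourhood_cover_of_clustering[where key = "\<lambda>v. (lab v, centre v)" and centre = snd,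
        OF graph])
    show "snd (lab v, centre v) \<in> V \<and> nbhd E v \<subseteq> graph_ball V E r (snd (lab v, centre v))"
      if "nbhd E v \<noteq> {}" for v
      using centre[OF that] Z(1) by auto
  next
    fix u
    let ?S = "SIGMA L:lab ` nbhd E u. Z L"
    have fin: "finite (nbhd E u)" "finite (Z L)" for L
      using finite_nbhd[OF graph(1)] finite_subset[OF Z(1) finite_graph_finite[OF graph(1)]] .
    have "nbhd E v \<noteq> {}" if "v \<in> nbhd E u" for v
      using that mem_nbhd_commute[of u E v] by auto
    then have "(\<lambda>v. (lab v, centre v)) ` nbhd E u \<subseteq> ?S" using centre by auto
    then have "card ((\<lambda>v. (lab v, centre v)) ` nbhd E u) \<le> card ?S"
      using fin by (intro card_mono) auto
    also have "\<dots> = (\<Sum>L\<in>lab ` nbhd E u. card (Z L))" using fin by (intro card_SigmaI) auto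
    also have "\<dots> \<le> card (lab ` nbhd E u) * d"
      using sum_bounded_above[of "lab ` nbhd E u" "\<lambda>L. card (Z L)" d] Z(2) by simp
    also have "\<dots> \<le> n * d" using labels by (rule mult_le_mono1)
    finally show "card ((\<lambda>v. (lab v, centre v)) ` nbhd E u) \<le> n * d" .
  qed
qed

section \<open>Merge sequences and their width\<close>

lemma parts_meeting_mono: "X \<subseteq> Y \<Longrightarrow> parts_meeting X P \<subseteq> parts_meeting Y P"
  by (auto simp: parts_meeting_def)

lemma part_of_in_parts_meeting:
  assumes "partition_on V P" "x \<in> X" "x \<in> V"
  shows "part_of P x \<in> parts_meeting X P"
  using part_of_in[OF assms(1,3)] assms(2) by (auto simp: parts_meeting_def)

lemma finite_parts_meeting:
  assumes "finite V" "partition_on V P"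
  shows "finite (parts_meeting X P)"
  using finite_elements[OF assms] by (simp add: parts_meeting_def)

lemma merge_sequence_partition_on:
  "merge_sequence V E m P R \<Longrightarrow> t \<in> {1..m} \<Longrightarrow> partition_on V (P t)"
  by (simp add: merge_sequence_def)

lemma merge_sequence_width_ge:
  assumes "finite V" "t \<in> {1..<m}" "v \<in> V"
  shows "card (parts_meeting (graph_ball V (R (t + 1)) r v) (P t)) \<le> merge_sequence_width V r m P R"
  unfolding merge_sequence_width_def
  using assms by (intro Max_ge) (auto intro!: image_eqI[of _ _ "(t, v)"])

lemma merge_sequence_width_mono:
  assumes "finite V" "V \<noteq> {}" "merge_sequence V E m P R" "2 \<le> m" "r \<le> r'"
  shows "merge_sequence_width V r m P R \<le> merge_sequence_width V r' m P R"
proof -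
  have "card (parts_meeting (graph_ball V (R (t + 1)) r v) (P t))
      \<le> merge_sequence_width V r' m P R" if t: "t \<in> {1..<m}" and v: "v \<in> V" for t v
  proof -
    have "partition_on V (P t)" using merge_sequence_partition_on[OF assms(3)] t by simp
    then have "card (parts_meeting (graph_ball V (R (t + 1)) r v) (P t))
        \<le> card (parts_meeting (graph_ball V (R (t + 1)) r' v) (P t))"
      using assms(1,5) by (intro card_mono finite_parts_meeting parts_meeting_mono graph_ball_mono)
    also have "\<dots> \<le> merge_sequence_width V r' m P R"
      using assms(1) t v by (rule merge_sequence_width_ge)
    finally show ?thesis .
  qed
  then show ?thesis
    unfolding merge_sequence_width_def[of V r] using assms(1,2,4) by (subst Max_le_iff) auto
qed

lemma merge_sequence_width_pos:
  assumes "finite V" "V \<noteq> {}" "merge_sequence V E m P R" "2 \<le> m"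
  shows "0 < merge_sequence_width V r m P R"
proof -
  obtain v where v: "v \<in> V" using assms(2) by blast
  let ?M = "parts_meeting (graph_ball V (R (1 + 1)) r v) (P 1)"
  have partition: "partition_on V (P 1)"
    using merge_sequence_partition_on[OF assms(3)] assms(4) by simp
  have "part_of (P 1) v \<in> ?M"
    using partition graph_ball_self[OF v] v by (rule part_of_in_parts_meeting)
  then have "0 < card ?M" using finite_parts_meeting[OF assms(1) partition] card_gt_0_iff by blast
  also have "\<dots> \<le> merge_sequence_width V r m P R"
    using assms(1,4) v by (intro merge_sequence_width_ge) auto
  finally show ?thesis .
qed

lemma merge_width_mono:
  assumes "finite V" "V \<noteq> {}" "r \<le> r'"
  shows "merge_width r V E \<le> merge_width r' V E"
proof -
  obtain m P R where seq: "merge_sequence V E m P R" "2 \<le> m"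
    and width: "merge_sequence_width V r' m P R = merge_width r' V E"
    using merge_width_attained[OF assms(2)] by blast
  have "merge_width r V E \<le> merge_sequence_width V r m P R"
    unfolding merge_width_def using seq by (intro cInf_lower) auto
  also have "\<dots> \<le> merge_width r' V E"
    unfolding width[symmetric] using assms(1,2) seq assms(3) by (rule merge_sequence_width_mono)
  finally show ?thesis .
qed

lemma merge_width_pos:
  assumes "finite V" "V \<noteq> {}"
  shows "0 < merge_width r V E"
  using merge_width_attained[OF assms(2)] merge_sequence_width_pos[OF assms] by metis

lemma merge_sequence_pad:
  assumes "merge_sequence V E m P R"
  shows "merge_sequence V E (m + 1) (P(m + 1 := {V})) (R(1 := {}, m + 1 := [V]\<^bsup>2\<^esup>))"
proof -
  let ?P = "P(m + 1 := {V})" and ?R = "R(1 := {}, m + 1 := [V]\<^bsup>2\<^esup>)"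
  have terms: "\<And>t. t \<in> {1..m} \<Longrightarrow>
      partition_on V (P t) \<and> R t \<subseteq> [V]\<^bsup>2\<^esup> \<and> homogeneous_mod E (R t) (P t)"
    and steps: "\<And>t. t \<in> {1..<m} \<Longrightarrow> refines V (P t) (P (t + 1)) \<and> R t \<subseteq> R (t + 1)"
    and ends: "1 \<le> m" "P 1 = (\<lambda>v. {v}) ` V" "P m = {V}"
    using assms by (auto simp: merge_sequence_def)
  have V: "partition_on V {V}" using terms[of m] ends by simp
  have "homogeneous_mod E {} (P 1)" unfolding ends(2) by (auto simp: homogeneous_mod_def)
  moreover have "homogeneous_mod E ([V]\<^bsup>2\<^esup>) {V}" by (auto simp: homogeneous_mod_def)
  ultimately have "partition_on V (?P t) \<and> ?R t \<subseteq> [V]\<^bsup>2\<^esup> \<and> homogeneous_mod E (?R t) (?P t)"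
    if "t \<in> {1..m + 1}" for t
    using that terms[of t] V by (cases "t = m + 1"; cases "t = 1") auto
  moreover have "refines V (?P t) (?P (t + 1)) \<and> ?R t \<subseteq> ?R (t + 1)" if "t \<in> {1..<m + 1}" for t
  proof (cases "t = m")
    case True
    then show ?thesis using terms[of m] ends V by (auto intro: refines_refl)
  next
    case False
    then show ?thesis using that steps[of t] by auto
  qed
  ultimately show ?thesis
    using ends unfolding merge_sequence_def by auto
qed

lemma merge_sequence_pad_width:
  assumes "finite V" "V \<noteq> {}" "merge_sequence V E m P R" "2 \<le> m"
    and t: "t \<in> {1..<m + 1}" and v: "v \<in> V"
  shows "card (parts_meeting (graph_ball V ((R(1 := {}, m + 1 := S)) (t + 1)) r v)
           ((P(m + 1 := {V})) t)) \<le> merge_sequence_width V r m P R"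
proof (cases "t = m")
  case True
  have "parts_meeting X {V} \<subseteq> {V}" for X by (auto simp: parts_meeting_def)
  then have "card (parts_meeting X {V}) \<le> card {V}" for X by (intro card_mono) auto
  also have "card {V} \<le> merge_sequence_width V r m P R"
    using merge_sequence_width_pos[OF assms(1-4)] by (simp add: Suc_le_eq)
  finally show ?thesis using True assms(3) by (simp add: merge_sequence_def)
next
  case False
  then show ?thesis
    using merge_sequence_width_ge[OF assms(1), of t m v R r P] t v by simp
qed

text \<open>
  \<open>R 1\<close> does not enter the width, and the pair appended at the end contributes only 1 to it. Their
  values make every edge spread at time 1 and none at time \<open>m\<close>.
\<close>

locale padded_merge_sequence =
  fixes V :: "'a set" and E :: "'a set set" and m k :: nat and P R :: "nat \<Rightarrow> 'a set set"
  assumes graph: "finite_graph V E"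
    and seq: "merge_sequence V E m P R"
    and R_1: "R 1 = {}"
    and R_m: "R m = [V]\<^bsup>2\<^esup>"
    and width: "\<And>t v. t \<in> {1..<m} \<Longrightarrow> v \<in> V \<Longrightarrow>
          card (parts_meeting (graph_ball V (R (t + 1)) 17 v) (P t)) \<le> k"
begin

abbreviation rball :: "nat \<Rightarrow> nat \<Rightarrow> 'a \<Rightarrow> 'a set" where
  "rball t r v \<equiv> graph_ball V (R t) r v"

abbreviation part :: "nat \<Rightarrow> 'a \<Rightarrow> 'a set" where
  "part t x \<equiv> part_of (P t) x"

abbreviation spread_at :: "nat \<Rightarrow> 'a \<Rightarrow> 'a \<Rightarrow> bool" where
  "spread_at t x y \<equiv> spread_pair V E (R t) (part t x) (part t y)"

definition last_spread_time :: "'a \<Rightarrow> 'a \<Rightarrow> nat" where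
  "last_spread_time x y = Max {t \<in> {1..m}. spread_at t x y}"

definition label :: "'a \<Rightarrow> 'a \<Rightarrow> nat \<times> 'a set \<times> 'a set" where
  "label x y = (last_spread_time x y,
     part (last_spread_time x y) x, part (last_spread_time x y) y)"

definition labels :: "'a \<Rightarrow> (nat \<times> 'a set \<times> 'a set) set" where
  "labels v = {label x y | x y. {v, x} \<in> E \<and> {x, y} \<in> E}"

lemmas finite_V = finite_graph_finite[OF graph]

lemmas edgeD = finite_graph_edgeD[OF graph]

lemmas partition = merge_sequence_partition_on[OF seq]

lemma R_subset_Suc: "t \<in> {1..<m} \<Longrightarrow> R t \<subseteq> R (t + 1)"
  and homogeneous: "t \<in> {1..m} \<Longrightarrow> homogeneous_mod E (R t) (P t)"
  and m_pos: "1 \<le> m"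
  using seq by (auto simp: merge_sequence_def)

lemma refines_le:
  assumes "t \<le> t'" "1 \<le> t" "t' \<le> m"
  shows "refines V (P t) (P t')"
  using assms
proof (induction t' rule: dec_induct)
  case base
  then show ?case using partition by (auto intro: refines_refl)
next
  case (step n)
  then have "refines V (P n) (P (Suc n))" using seq by (auto simp: merge_sequence_def)
  then show ?case using step by (auto intro: refines_trans)
qed

lemma part_mono:
  assumes "1 \<le> t" "t \<le> t'" "t' \<le> m" "x \<in> V" "y \<in> V" "part t x = part t y"
  shows "part t' x = part t' y"
  using part_of_eq_refines[OF refines_le] assms by blast

lemma spread_at_start:
  assumes "{x, y} \<in> E"
  shows "spread_at 1 x y"
proof -
  have xy: "x \<in> V" "y \<in> V" "x \<noteq> y" using edgeD assms by auto
  have "P 1 = (\<lambda>v. {v}) ` V" using seq by (simp add: merge_sequence_def)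
  then have "part 1 x = {x}" "part 1 y = {y}"
    using part_of_eqI[OF partition[of 1]] m_pos xy by auto
  moreover have "\<not> {x, y} \<subseteq> rball 1 4 z" for z
    using xy graph_ball_no_edges[of V 4 z] unfolding R_1 by blast
  ultimately show ?thesis
    using assms unfolding spread_pair_def complete_mod_def by fastforce
qed

lemma not_spread_at_end:
  assumes "x \<in> V"
  shows "\<not> spread_at m x y"
proof -
  have "part m x \<union> part m y \<subseteq> V" using part_of_subset partition m_pos by fastforce
  also have "V \<subseteq> rball m 4 x" unfolding R_m using assms by (intro graph_ball_complete) auto
  finally show ?thesis using assms unfolding spread_pair_def by blast
qed

lemma last_spread_time_ge: "t \<in> {1..m} \<Longrightarrow> spread_at t x y \<Longrightarrow> t \<le> last_spread_time x y"
  unfolding last_spread_time_def by (intro Max_ge) auto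

lemma last_spread_time:
  assumes "{x, y} \<in> E"
  shows "last_spread_time x y \<in> {1..<m}" "spread_at (last_spread_time x y) x y"
proof -
  let ?S = "{t \<in> {1..m}. spread_at t x y}"
  have "1 \<in> ?S" using spread_at_start[OF assms] m_pos by simp
  then have max: "last_spread_time x y \<in> ?S" unfolding last_spread_time_def by (intro Max_in) auto
  then show "spread_at (last_spread_time x y) x y" by simp
  then have "last_spread_time x y \<noteq> m" using not_spread_at_end[of x y] edgeD[OF assms] by auto
  then show "last_spread_time x y \<in> {1..<m}" using max by auto
qed

lemma edge_near_after_last_spread_time:
  assumes e: "{x, y} \<in> E" and t: "last_spread_time x y < t" "t \<le> m"
  shows "y \<in> rball t 8 x"
proof -
  have tm: "t \<in> {1..m}" using t by auto
  have xy: "x \<in> V" "y \<in> V" "x \<noteq> y" using edgeD e by auto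
  note parts = part_of_in[OF partition[OF tm] xy(1)] part_of_in[OF partition[OF tm] xy(2)]
  have "\<not> spread_at t x y" using last_spread_time_ge[OF tm] t by (meson leD)
  then consider (incomplete) "\<not> complete_mod E (R t) (part t x) (part t y)"
    | (clustered) z where "z \<in> V" "part t x \<union> part t y \<subseteq> rball t 4 z"
    by (auto simp: spread_pair_def)
  then show ?thesis
  proof cases
    case incomplete
    then have "{x, y} \<in> R t"
      using homogeneous_mod_complete_mod[OF homogeneous[OF tm]] parts xy(3) e by blast
    then have "y \<in> rball t 1 x" using graph_ball_edge xy by auto
    then show ?thesis using graph_ball_mono[of 1 8 V "R t" x] by auto
  next
    case clustered
    then have "x \<in> rball t 4 z" "y \<in> rball t 4 z" using parts by auto
    then have "y \<in> rball t (4 + 4) x" using graph_ball_sym graph_ball_trans clustered(1) by metis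
    then show ?thesis by simp
  qed
qed

lemma label_cong:
  assumes e: "{x, y} \<in> E" "{x', y'} \<in> E"
    and t: "1 \<le> t" "t \<le> last_spread_time x y"
    and eq: "part t x = part t x'" "part t y = part t y'"
  shows "label x y = label x' y'"
proof -
  let ?s = "last_spread_time x y" and ?s' = "last_spread_time x' y'"
  have V: "x \<in> V" "y \<in> V" "x' \<in> V" "y' \<in> V" using edgeD[OF e(1)] edgeD[OF e(2)] by auto
  have later: "part t' x = part t' x'" "part t' y = part t' y'" if "t \<le> t'" "t' \<le> m" for t'
    by (rule part_mono[OF t(1) that], use V eq in simp_all)+
  note s = last_spread_time[OF e(1)] and s' = last_spread_time[OF e(2)]
  have le: "?s \<le> ?s'"
    using s later[of ?s] t(2) by (intro last_spread_time_ge) auto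
  moreover have "?s' \<le> ?s"
    using s' later[of ?s'] t(2) le by (intro last_spread_time_ge) auto
  ultimately have "?s = ?s'" by simp
  then show ?thesis using later[of ?s] t(2) s(1) by (simp add: label_def)
qed

lemma label_two_centres:
  "\<exists>Z\<subseteq>V. card Z \<le> 2 \<and>
     (\<forall>x y. {x, y} \<in> E \<and> label x y = L \<longrightarrow> (\<exists>z\<in>Z. x \<in> graph_ball V E 2 z))"
proof (cases "\<exists>x0 y0. {x0, y0} \<in> E \<and> label x0 y0 = L")
  case True
  then obtain x0 y0 where e0: "{x0, y0} \<in> E" "label x0 y0 = L" by blast
  obtain t X Y where L: "L = (t, X, Y)" by (cases L)
  have t: "t \<in> {1..m}" and spread: "spread_pair V E (R t) X Y"
    using last_spread_time[OF e0(1)] e0(2) L by (auto simp: label_def)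
  have V: "X \<subseteq> V" "Y \<subseteq> V"
    using e0(2) L part_of_subset[OF partition[OF t]] by (auto simp: label_def)
  obtain Z where Z: "Z \<subseteq> V" "card Z \<le> 2"
    "\<And>x y. x \<in> X \<Longrightarrow> y \<in> Y \<Longrightarrow> {x, y} \<in> E \<Longrightarrow> \<exists>z\<in>Z. x \<in> graph_ball V E 2 z"
    using spread_pair_two_centres[OF graph spread V] by blast
  have "x \<in> X" "y \<in> Y" if "{x, y} \<in> E" "label x y = L" for x y
    using that part_of_in(2)[OF partition[OF t]] edgeD[OF that(1)] L by (auto simp: label_def)
  then have "\<exists>z\<in>Z. x \<in> graph_ball V E 2 z" if "{x, y} \<in> E" "label x y = L" for x y
    using Z(3) that by metis
  then show ?thesis using Z(1,2) by (intro exI[of _ Z]) auto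
next
  case False
  then show ?thesis by (intro exI[of _ "{}"]) simp
qed

lemma same_part_far_adjacent:
  assumes t: "t \<in> {1..<m}" and V: "a' \<in> V"
    and near: "a \<in> rball (t + 1) r u" "a' \<in> rball (t + 1) r u"
    and far: "b \<notin> rball (t + 1) (r + 1) u"
    and e: "{a, b} \<in> E" and eq: "part t a = part t a'"
  shows "{a', b} \<in> E"
proof -
  have tm: "t \<in> {1..m}" using t by auto
  have ab: "a \<in> V" "b \<in> V" "a \<noteq> b" using edgeD e by auto
  have not_R: "{c, b} \<notin> R t \<and> c \<noteq> b" if "c \<in> rball (t + 1) r u" for c
  proof -
    have "b \<notin> rball (t + 1) 1 c" using graph_ball_trans[OF that] far by blast
    then show ?thesis
      using R_subset_Suc[OF t] graph_ball_edge[of c b "R (t + 1)" V]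
        graph_ball_self[of b V "R (t + 1)" 1] ab(2) by auto
  qed
  have "complete_mod E (R t) (part t a) (part t b)"
    using homogeneous_mod_complete_mod[OF homogeneous[OF tm]] part_of_in[OF partition[OF tm]]
      ab e not_R[OF near(1)] by blast
  moreover have "a' \<in> part t a" "b \<in> part t b"
    using part_of_in(2)[OF partition[OF tm]] V ab(2) eq by auto
  ultimately show ?thesis using not_R[OF near(2)] unfolding complete_mod_def by blast
qed

end

section \<open>Choosing a latest walk from every vertex\<close>

locale latest_walk_choice = padded_merge_sequence +
  fixes mid tip :: "'a \<Rightarrow> 'a"
  assumes walk: "nbhd E v \<noteq> {} \<Longrightarrow> {v, mid v} \<in> E \<and> {mid v, tip v} \<in> E"
    and latest: "{v, x} \<in> E \<Longrightarrow> {x, y} \<in> E \<Longrightarrow>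
          last_spread_time x y \<le> last_spread_time (mid v) (tip v)"
    and consistent: "nbhd E v \<noteq> {} \<Longrightarrow> nbhd E v' \<noteq> {} \<Longrightarrow>
          label (mid v) (tip v) \<in> labels v' \<Longrightarrow> label (mid v') (tip v') \<in> labels v \<Longrightarrow>
          label (mid v) (tip v) = label (mid v') (tip v')"

lemma (in padded_merge_sequence) latest_walk_choice_exists:
  "\<exists>mid tip. latest_walk_choice V E m k P R mid tip"
proof -
  let ?W = "{v. nbhd E v \<noteq> {}}"
  have "labels v \<subseteq> (\<lambda>(x, y). label x y) ` (V \<times> V)" for v
    using edgeD by (force simp: labels_def)
  then have "finite (\<Union>v\<in>?W. labels v)"
    using finite_V by (meson UN_least finite_SigmaI finite_imageI finite_subset)
  moreover have "labels v \<noteq> {}" if v: "v \<in> ?W" for v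
  proof -
    obtain x where "{v, x} \<in> E" "{x, v} \<in> E"
      using v by (auto simp: nbhd_def insert_commute)
    then show ?thesis unfolding labels_def by blast
  qed
  ultimately obtain lab
    where lab: "\<And>v. v \<in> ?W \<Longrightarrow> is_arg_max fst (\<lambda>L. L \<in> labels v) (lab v)"
      and consistent: "\<And>v v'. v \<in> ?W \<Longrightarrow> v' \<in> ?W \<Longrightarrow>
            lab v \<in> labels v' \<Longrightarrow> lab v' \<in> labels v \<Longrightarrow> lab v = lab v'"
    using consistent_maximal_choice[of labels ?W fst] by blast
  have "\<exists>x y. {v, x} \<in> E \<and> {x, y} \<in> E \<and> lab v = label x y" if "v \<in> ?W" for v
    using lab[OF that] unfolding is_arg_max_def labels_def by blast
  then obtain mid tip where walk: "\<And>v. v \<in> ?W \<Longrightarrow>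
      {v, mid v} \<in> E \<and> {mid v, tip v} \<in> E \<and> lab v = label (mid v) (tip v)"
    by metis
  have "latest_walk_choice V E m k P R mid tip"
  proof unfold_locales
    fix v x y assume xy: "{v, x} \<in> E" "{x, y} \<in> E"
    then have v: "v \<in> ?W" and mem: "label x y \<in> labels v" by (auto simp: nbhd_def labels_def)
    then have "fst (label x y) \<le> fst (lab v)"
      using lab[OF v] unfolding is_arg_max_linorder by blast
    also have "lab v = label (mid v) (tip v)" using walk[OF v] by blast
    finally show "last_spread_time x y \<le> last_spread_time (mid v) (tip v)"
      by (simp add: label_def)
  qed (use walk consistent in auto)
  then show ?thesis by blast
qed

context latest_walk_choice
begin

definition lab :: "'a \<Rightarrow> nat \<times> 'a set \<times> 'a set" where
  "lab v = label (mid v) (tip v)"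

definition time :: "'a \<Rightarrow> nat" where
  "time v = last_spread_time (mid v) (tip v)"

lemmas lab_consistent = consistent[folded lab_def]

context
  fixes u w :: 'a
  assumes earliest: "is_arg_min time (\<lambda>v. v \<in> nbhd E u) w"
begin

abbreviation near :: "nat \<Rightarrow> 'a set" where
  "near r \<equiv> rball (time w + 1) r u"

abbreviation near_parts :: "'a set set" where
  "near_parts \<equiv> parts_meeting (near 17) (P (time w))"

abbreviation cell :: "'a \<Rightarrow> 'a set" where
  "cell z \<equiv> part (time w) z"

lemma nbhd_walk:
  assumes "v \<in> nbhd E u"
  shows "{u, v} \<in> E" "{v, u} \<in> E" "{v, mid v} \<in> E" "{mid v, tip v} \<in> E" "nbhd E v \<noteq> {}"
proof -
  show "{u, v} \<in> E" "{v, u} \<in> E" using assms by (auto simp: nbhd_def insert_commute)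
  then show "nbhd E v \<noteq> {}" by (auto simp: nbhd_def)
  then show "{v, mid v} \<in> E" "{mid v, tip v} \<in> E" using walk by auto
qed

lemma lab_in_labels: "v \<in> nbhd E u \<Longrightarrow> {v', mid v} \<in> E \<Longrightarrow> lab v \<in> labels v'"
  using nbhd_walk(4) unfolding lab_def labels_def by blast

lemma earliest_in_nbhd: "w \<in> nbhd E u"
  and time_earliest_le: "v \<in> nbhd E u \<Longrightarrow> time w \<le> time v"
  using earliest by (auto simp: is_arg_min_linorder)

lemma time_earliest: "time w \<in> {1..<m}"
  using last_spread_time(1) nbhd_walk(4)[OF earliest_in_nbhd] unfolding time_def by blast

lemma near_mono: "r \<le> r' \<Longrightarrow> near r \<subseteq> near r'"
  by (rule graph_ball_mono)

lemma edge_near_after_earliest: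
  assumes "{w, x} \<in> E" "{x, y} \<in> E"
  shows "y \<in> rball (time w + 1) 8 x"
  using edge_near_after_last_spread_time[OF assms(2), of "time w + 1"] latest[OF assms]
    time_earliest by (auto simp: time_def)

lemma nbhd_subset_near: "nbhd E u \<subseteq> near 8"
  using edge_near_after_earliest nbhd_walk(1,2) earliest_in_nbhd by blast

lemma nbhd_earliest_subset_near: "nbhd E w \<subseteq> near 16"
proof
  fix x assume "x \<in> nbhd E w"
  then have e: "{w, x} \<in> E" "{x, w} \<in> E" by (auto simp: nbhd_def insert_commute)
  then have "w \<in> rball (time w + 1) 8 x" using edge_near_after_earliest by blast
  then have "x \<in> rball (time w + 1) 8 w" using graph_ball_sym edgeD[OF e(1)] by metis
  moreover have "w \<in> near 8" using nbhd_subset_near earliest_in_nbhd by blast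
  ultimately have "x \<in> near (8 + 8)" by (rule graph_ball_trans[rotated])
  then show "x \<in> near 16" by simp
qed

lemma cell_in_near_parts:
  assumes "z \<in> near 17"
  shows "cell z \<in> near_parts"
proof (rule part_of_in_parts_meeting[OF partition assms])
  show "time w \<in> {1..m}" using time_earliest by auto
  show "z \<in> V" using assms by (simp add: graph_ball_def)
qed

lemma finite_near_parts: "finite near_parts"
  using finite_parts_meeting[OF finite_V partition] time_earliest by auto

lemma card_near_parts: "card near_parts \<le> k"
  using width[OF time_earliest] edgeD[OF nbhd_walk(1)[OF earliest_in_nbhd]] by simp

lemma far_mid_adjacent:
  assumes "v \<in> nbhd E u" "v' \<in> nbhd E u" "mid v \<notin> near 16"
    and "cell v = cell v'"
  shows "{v', mid v} \<in> E"
proof (rule same_part_far_adjacent[OF time_earliest])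
  show "v' \<in> V" using edgeD[OF nbhd_walk(1)[OF assms(2)]] by simp
  show "v \<in> near 8" "v' \<in> near 8" using nbhd_subset_near assms(1,2) by auto
  show "mid v \<notin> near (8 + 1)" using near_mono[of "8 + 1" 16] assms(3) by auto
  show "{v, mid v} \<in> E" using nbhd_walk(3)[OF assms(1)] .
qed (rule assms(4))

text \<open>Saving the part of \<open>w\<close> is what yields \<open>2k\<^sup>2\<close> labels in total also for \<open>k = 1\<close>.\<close>

lemma card_labels_mid_far: "card (lab ` {v \<in> nbhd E u. mid v \<notin> near 16}) \<le> k - 1"
proof -
  let ?F = "{v \<in> nbhd E u. mid v \<notin> near 16}"
  have cell_w: "cell w \<in> near_parts"
    using cell_in_near_parts nbhd_subset_near earliest_in_nbhd near_mono[of 8 17] by auto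
  have "card (lab ` ?F) \<le> card (near_parts - {cell w})"
  proof (rule card_image_le_of_factor[where g = cell])
    show "cell ` ?F \<subseteq> near_parts - {cell w}"
    proof (rule image_subsetI)
      fix v assume v: "v \<in> ?F"
      then have "cell v \<noteq> cell w"
        using far_mid_adjacent earliest_in_nbhd nbhd_earliest_subset_near
        by (auto simp: nbhd_def)
      moreover have "v \<in> near 17" using v nbhd_subset_near near_mono[of 8 17] by auto
      ultimately show "cell v \<in> near_parts - {cell w}"
        using cell_in_near_parts by blast
    qed
    fix v v' assume v: "v \<in> ?F" "v' \<in> ?F" "cell v = cell v'"
    then have "{v', mid v} \<in> E" "{v, mid v'} \<in> E" using far_mid_adjacent by auto
    then have "lab v \<in> labels v'" "lab v' \<in> labels v" using lab_in_labels v(1,2) by auto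
    then show "lab v = lab v'" using lab_consistent nbhd_walk(5) v(1,2) by simp
  qed (use finite_near_parts in simp)
  also have "\<dots> \<le> k - 1" using cell_w card_near_parts finite_near_parts by simp
  finally show ?thesis .
qed

lemma label_mid_tip_cong:
  assumes "v \<in> nbhd E u" "{x, y} \<in> E"
    and "cell (mid v) = cell x" "cell (tip v) = cell y"
  shows "lab v = label x y"
  unfolding lab_def
  using label_cong[OF nbhd_walk(4)[OF assms(1)] assms(2) _ _ assms(3,4)] time_earliest
    time_earliest_le[OF assms(1)] by (simp add: time_def)

lemma card_labels_tip_far:
  "card (lab ` {v \<in> nbhd E u. mid v \<in> near 16 \<and> tip v \<notin> near 17}) \<le> k"
proof -
  let ?F = "{v \<in> nbhd E u. mid v \<in> near 16 \<and> tip v \<notin> near 17}"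
  have lab_mem: "lab v \<in> labels v'"
    if v: "v \<in> ?F" "v' \<in> ?F" "cell (mid v) = cell (mid v')" for v v'
  proof -
    have "{mid v', tip v} \<in> E"
    proof (rule same_part_far_adjacent[OF time_earliest])
      show "mid v' \<in> V" using edgeD[OF nbhd_walk(3)] v(2) by simp
      show "mid v \<in> near 16" "mid v' \<in> near 16" "tip v \<notin> near (16 + 1)" using v by auto
      show "{mid v, tip v} \<in> E" using nbhd_walk(4) v(1) by blast
    qed (rule v(3))
    moreover from this have "lab v = label (mid v') (tip v)"
      using label_mid_tip_cong[of v "mid v'" "tip v"] v by simp
    ultimately show ?thesis using nbhd_walk(3) v(2) unfolding labels_def by blast
  qed
  have "card (lab ` ?F) \<le> card near_parts"
  proof (rule card_image_le_of_factor[where g = "\<lambda>v. cell (mid v)"])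
    show "(\<lambda>v. cell (mid v)) ` ?F \<subseteq> near_parts"
      using cell_in_near_parts near_mono[of 16 17] by auto
    fix v v' assume v: "v \<in> ?F" "v' \<in> ?F" "cell (mid v) = cell (mid v')"
    have "lab v \<in> labels v'" "lab v' \<in> labels v"
      using lab_mem[OF v] lab_mem[OF v(2,1) v(3)[symmetric]] .
    then show "lab v = lab v'" using lab_consistent nbhd_walk(5) v(1,2) by simp
  qed (rule finite_near_parts)
  then show ?thesis using card_near_parts by linarith
qed

lemma card_labels_both_near:
  "card (lab ` {v \<in> nbhd E u. mid v \<in> near 16 \<and> tip v \<in> near 17}) \<le> k * k"
proof -
  let ?F = "{v \<in> nbhd E u. mid v \<in> near 16 \<and> tip v \<in> near 17}"
  have "card (lab ` ?F) \<le> card (near_parts \<times> near_parts)"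
  proof (rule card_image_le_of_factor[where g = "\<lambda>v. (cell (mid v), cell (tip v))"])
    show "(\<lambda>v. (cell (mid v), cell (tip v))) ` ?F \<subseteq> near_parts \<times> near_parts"
      using cell_in_near_parts near_mono[of 16 17] by auto
    fix v v' assume "v \<in> ?F" "v' \<in> ?F" "(cell (mid v), cell (tip v)) =
      (cell (mid v'), cell (tip v'))"
    then show "lab v = lab v'"
      using label_mid_tip_cong[of v "mid v'" "tip v'"] nbhd_walk(4) by (simp add: lab_def)
  qed (use finite_near_parts in simp)
  also have "\<dots> \<le> k * k" using card_near_parts by (simp add: card_cartesian_product mult_mono)
  finally show ?thesis .
qed

lemma card_labels_nbhd_earliest: "card (lab ` nbhd E u) \<le> 2 * k\<^sup>2"
proof -
  let ?far = "{v \<in> nbhd E u. mid v \<notin> near 16}"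
    and ?tip_far = "{v \<in> nbhd E u. mid v \<in> near 16 \<and> tip v \<notin> near 17}"
    and ?near = "{v \<in> nbhd E u. mid v \<in> near 16 \<and> tip v \<in> near 17}"
  have split: "lab ` nbhd E u = lab ` ?far \<union> (lab ` ?tip_far \<union> lab ` ?near)" by auto
  have "card (lab ` nbhd E u) \<le> card (lab ` ?far) + (card (lab ` ?tip_far) + card (lab ` ?near))"
    unfolding split using card_Un_le[of "lab ` ?far" "lab ` ?tip_far \<union> lab ` ?near"]
      card_Un_le[of "lab ` ?tip_far" "lab ` ?near"] by linarith
  also have "\<dots> \<le> (k - 1) + (k + k * k)"
    using card_labels_mid_far card_labels_tip_far card_labels_both_near by (intro add_mono)
  also have "\<dots> \<le> 2 * k\<^sup>2" by (cases k) (simp_all add: power2_eq_square)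
  finally show ?thesis .
qed

end

lemma card_labels_nbhd: "card (lab ` nbhd E u) \<le> 2 * k\<^sup>2"
proof (cases "nbhd E u = {}")
  case False
  then obtain w where "is_arg_min time (\<lambda>v. v \<in> nbhd E u) w"
    using ex_is_arg_min_if_finite finite_nbhd[OF graph] by metis
  then show ?thesis by (rule card_labels_nbhd_earliest)
qed simp

lemma nbhd_subset_ball_of_mid:
  assumes "nbhd E v \<noteq> {}" "mid v \<in> graph_ball V E r z"
  shows "nbhd E v \<subseteq> graph_ball V E (r + 2) z"
proof
  fix x assume "x \<in> nbhd E v"
  then have "x \<in> graph_ball V E 2 (mid v)"
    using walk[OF assms(1)] graph_ball_common_neighbour[OF graph, of x v "mid v"]
    by (auto simp: nbhd_def insert_commute)
  then show "x \<in> graph_ball V E (r + 2) z" by (rule graph_ball_trans[OF assms(2)])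
qed

lemma neighbourhood_cover_exists:
  assumes "E \<noteq> {}"
  shows "\<exists>K. neighbourhood_cover V E (4 * k\<^sup>2) 4 K"
proof -
  obtain Z where Z: "\<And>L. Z L \<subseteq> V" "\<And>L. card (Z L) \<le> 2"
    and near: "\<And>x y. {x, y} \<in> E \<Longrightarrow> \<exists>z\<in>Z (label x y). x \<in> graph_ball V E 2 z"
    using label_two_centres by metis
  have centre: "\<exists>c\<in>Z (lab v). nbhd E v \<subseteq> graph_ball V E 4 c" if v: "nbhd E v \<noteq> {}" for v
  proof -
    obtain z where "z \<in> Z (lab v)" "mid v \<in> graph_ball V E 2 z"
      using near walk[OF v] unfolding lab_def by blast
    then show ?thesis using nbhd_subset_ball_of_mid[OF v, of 2 z] by auto
  qed
  have "\<exists>K. neighbourhood_cover V E (2 * k\<^sup>2 * 2) 4 K"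
    by (rule neighbourhood_cover_of_labelling[OF graph assms Z centre card_labels_nbhd])
  then show ?thesis by (simp add: mult.commute)
qed

end

lemma merge_width_neighbourhood_cover:
  assumes graph: "finite_graph V E" and "E \<noteq> {}"
  shows "\<exists>K. neighbourhood_cover V E (4 * (merge_width 17 V E)\<^sup>2) 4 K"
proof -
  let ?k = "merge_width 17 V E"
  have V: "finite V" "V \<noteq> {}"
    using finite_graph_finite[OF graph] finite_graph_nonempty[OF graph assms(2)] .
  obtain m P R where seq: "merge_sequence V E m P R" "2 \<le> m"
    and width: "merge_sequence_width V 17 m P R = ?k"
    using merge_width_attained[OF V(2)] by blast
  let ?P = "P(m + 1 := {V})" and ?R = "R(1 := {}, m + 1 := [V]\<^bsup>2\<^esup>)"
  interpret padded_merge_sequence V E "m + 1" ?k ?P ?R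
    using graph merge_sequence_pad[OF seq(1)] seq(2)
      merge_sequence_pad_width[OF V seq, of _ _ "[V]\<^bsup>2\<^esup>" 17, unfolded width]
    by unfold_locales auto
  obtain mid tip where "latest_walk_choice V E (m + 1) ?k ?P ?R mid tip"
    using latest_walk_choice_exists by blast
  then show ?thesis using assms(2) by (rule latest_walk_choice.neighbourhood_cover_exists)
qed

theorem theorem8p6:
  fixes V :: "'a set" and E :: "'a set set" and k l :: nat
  assumes "finite_graph V E"
    and "k = merge_width 37 V E"
    and "l = k * nbhd_complexity V E k"
  shows "\<exists>K. neighbourhood_cover V E (l ^ 2) 38 K"
proof (cases "E = {}")
  case True
  have "1 \<le> l ^ 2" if "V \<noteq> {}"
    using merge_width_pos[OF finite_graph_finite[OF assms(1)] that, of 37 E]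
      nbhd_complexity_pos[OF finite_graph_finite[OF assms(1)] that, of E k] assms(2,3)
    by (simp add: Suc_le_eq)
  then show ?thesis unfolding True by (rule neighbourhood_cover_no_edges)
next
  case False
  let ?k' = "merge_width 17 V E"
  have V: "finite V" "V \<noteq> {}"
    using finite_graph_finite[OF assms(1)] finite_graph_nonempty[OF assms(1) False] .
  obtain K where K: "neighbourhood_cover V E (4 * ?k'\<^sup>2) 4 K"
    using merge_width_neighbourhood_cover[OF assms(1) False] by blast
  have "?k' \<le> k" using merge_width_mono[OF V, of 17 37 E] assms(2) by simp
  moreover have "2 \<le> nbhd_complexity V E k"
    using nbhd_complexity_ge_2[OF assms(1) False] merge_width_pos[OF V] assms(2) by blast
  ultimately have "?k' * 2 \<le> l" unfolding assms(3) by (rule mult_le_mono)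
  then have "(?k' * 2)\<^sup>2 \<le> l\<^sup>2" by (rule power_mono) simp
  then show ?thesis
    using neighbourhood_cover_mono[OF K, of "l\<^sup>2" 38] by (auto simp: power_mult_distrib mult.commute)
qed

end
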